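(* Let $x=(x_t(s,a))$ be an optimal occupation measure. If a policy $\pi$ is fluid consistent (with respect to $x$), then $V_N^* - V_N(\pi) = o(N)$ as $N\to\infty$.
   Context: Model. Fix, independently of $N$: a finite set $S$ (single-arm states), $A=\{0,1\}$ ($1$ = pull, $0$ = idle), a horizon $T$, $[T]=\{1,\dots,T\}$, transition kernels $p_t(s,a,s')$, rewards $r_t:S\times A\to\mathbb{R}$, rational budget ratios $\alpha_t\in[0,1]$, and an initial state $s^*\in S$. $N$ ranges over positive integers for which $\alpha_t N$ is an integer for all $t\in[T]$. There are $N$ arms, all in state $s^*$ at time $1$. At each time $t\in[T]$ every arm $i$ with state $s_{t,i}$ receives an action $a_{t,i}\in A$ chosen based on the current states and $t$; then, conditionally independently across arms, arm $i$ moves to state $s'$ with probability $p_t(s_{t,i},a_{t,i},s')$. The total reward at time $t$ is $R_t=\sum_{i=1}^N r_t(s_{t,i},a_{t,i})$. The budget constraint requires that exactly $\alpha_tN$ arms are pulled at each time $t$. Let $Z^N_t(s)$ be the number of arms in state $s$ at time $t$ and $X^N_t(s,a)$ the number of arms in state $s$ to which action $a$ is applied at time $t$. A policy $\pi$ is identified with maps (for each $N$ and $t$) $Z^N_t\mapsto X^N_t=\pi(t,Z^N_t)$ with $\sum_{a}X^N_t(s,a)=Z^N_t(s)$ and $\sum_s X^N_t(s,1)=\alpha_tN$. Its value is $V_N(\pi)=\mathbb{E}_\pi\sum_{t=1}^T R_t$, and $V_N^*=\sup_\pi V_N(\pi)$ over policies satisfying the budget constraint. Optimal occupation measure. A solution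 $x=(x_t(s,a))_{t\in[T],s\in S,a\in A}$ of the linear program: maximize $\sum_{t=1}^T\sum_{s,a} r_t(s,a)x_t(s,a)$ subject to $\sum_a x_t(s,a)=\sum_{a}\sum_{s'} x_{t-1}(s',a)p_{t-1}(s',a,s)$ for all $s\in S$, $2\le t\le T$; $\sum_s x_t(s,1)=\alpha_t$ for $t\in[T]$; $\sum_a x_1(s^*,a)=1$; $\sum_{s,a}x_1(s,a)=1$; $x_t(s,a)\ge 0$. Write $x_t=(x_t(s,a))_{s,a}$, $z_t(s)=\sum_a x_t(s,a)$, $z_t=(z_t(s))_s$. Fluid consistency. A policy $\pi$ is fluid consistent (with respect to a fixed optimal occupation measure $x$) if, for all $t\in[T]$ and all sequences $(Z^N_t)_N$ satisfying $Z^N_t/N\to z_t$ as $N\to\infty$, one has $\pi(t,Z^N_t)/N\to x_t$. *)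

theory Defs
  imports "HOL-Probability.Probability" "HOL-Library.Landau_Symbols"
begin

text \<open>
  Actions are of type \<^typ>\<open>bool\<close>: \<^const>\<open>True\<close> is the action 1 (pull), \<^const>\<open>False\<close> the
  action 0 (idle). The state space is the finite type of single-arm states. Time runs over
  \<open>{1..horizon B}\<close>; whatever the components specify outside this range is never used.
\<close>

record 's bandit =
  horizon :: nat
  trans :: "nat \<Rightarrow> 's \<Rightarrow> bool \<Rightarrow> 's pmf"
  reward :: "nat \<Rightarrow> 's \<Rightarrow> bool \<Rightarrow> real"
  budget :: "nat \<Rightarrow> real"
  init_state :: 's

definition valid_bandit :: "'s::finite bandit \<Rightarrow> bool" where
  "valid_bandit B \<longleftrightarrow>
     1 \<le> horizon B \<and> (\<forall>t\<in>{1..horizon B}. budget B t \<in> \<rat> \<and> 0 \<le> budget B t \<and> budget B t \<le> 1)"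

definition admissible :: "'s::finite bandit \<Rightarrow> nat \<Rightarrow> bool" where
  "admissible B N \<longleftrightarrow> 0 < N \<and> (\<forall>t\<in>{1..horizon B}. budget B t * real N \<in> \<int>)"

text \<open>\<open>N\<close> tends to infinity along the admissible numbers of arms only.\<close>

definition large_N :: "'s::finite bandit \<Rightarrow> nat filter" where
  "large_N B = inf sequentially (principal {N. admissible B N})"


subsection \<open>Policies\<close>

type_synonym 's policy = "nat \<Rightarrow> nat \<Rightarrow> ('s \<Rightarrow> nat) \<Rightarrow> 's \<Rightarrow> bool \<Rightarrow> nat"

text \<open>
  \<open>\<pi> N t Z s a\<close> is the number of arms in state \<open>s\<close> to which action \<open>a\<close> is applied at time
  \<open>t\<close>, if there are \<open>N\<close> arms in total and \<open>Z s'\<close> of them are in state \<open>s'\<close>, for each \<open>s'\<close>.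
\<close>

definition is_policy :: "'s::finite bandit \<Rightarrow> 's policy \<Rightarrow> bool" where
  "is_policy B \<pi> \<longleftrightarrow>
     (\<forall>N t Z. admissible B N \<longrightarrow> t \<in> {1..horizon B} \<longrightarrow> (\<Sum>s\<in>UNIV. Z s) = N \<longrightarrow>
        (\<forall>s. (\<Sum>a\<in>UNIV. \<pi> N t Z s a) = Z s) \<and>
        real (\<Sum>s\<in>UNIV. \<pi> N t Z s True) = budget B t * real N)"


subsection \<open>Dynamics of the arms and value of a policy\<close>

text \<open>
  A joint state \<open>\<sigma> :: nat \<Rightarrow> 's\<close> gives the state of each of the arms \<open>1, \<dots>, N\<close>;
  its values at other indices are irrelevant.
\<close>

definition state_count :: "nat \<Rightarrow> (nat \<Rightarrow> 's) \<Rightarrow> 's \<Rightarrow> nat" where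
  "state_count N \<sigma> s = card {i\<in>{1..N}. \<sigma> i = s}"

definition action_count :: "nat \<Rightarrow> (nat \<Rightarrow> 's) \<Rightarrow> (nat \<Rightarrow> bool) \<Rightarrow> 's \<Rightarrow> bool \<Rightarrow> nat" where
  "action_count N \<sigma> act s a = card {i\<in>{1..N}. \<sigma> i = s \<and> act i = a}"

text \<open>
  A policy determines only the numbers of arms per state and action. Which of the arms in the
  same state are pulled is settled by an arbitrary choice; it affects neither the reward nor the
  law of the future state counts, since arms in the same state are exchangeable.
\<close>

definition arm_actions :: "'s policy \<Rightarrow> nat \<Rightarrow> nat \<Rightarrow> (nat \<Rightarrow> 's) \<Rightarrow> nat \<Rightarrow> bool" where
  "arm_actions \<pi> N t \<sigma> = (SOME act. action_count N \<sigma> act = \<pi> N t (state_count N \<sigma>))"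

lemma ex_action_count:
  fixes \<sigma> :: "nat \<Rightarrow> 's"
  assumes "\<And>s. (\<Sum>a\<in>UNIV. X s a) = state_count N \<sigma> s"
  shows "\<exists>act. action_count N \<sigma> act = X"
proof -
  let ?A = "\<lambda>s. {i\<in>{1..N}. \<sigma> i = s}"
  have card_A: "card (?A s) = X s True + X s False" for s
    using assms[of s] by (simp add: state_count_def UNIV_bool)
  have "\<exists>P. P \<subseteq> ?A s \<and> card P = X s True" for s
    using card_A[of s] obtain_subset_with_card_n[of "X s True" "?A s"] by auto
  then obtain P where P: "\<And>s. P s \<subseteq> ?A s" "\<And>s. card (P s) = X s True"
    by metis
  have "action_count N \<sigma> (\<lambda>i. i \<in> P (\<sigma> i)) s a = X s a" for s a
  proof (cases a)
    case True
    have "{i\<in>{1..N}. \<sigma> i = s \<and> (i \<in> P (\<sigma> i)) = a} = P s"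
      using P(1)[of s] True by auto
    then show ?thesis using P(2)[of s] True by (simp add: action_count_def)
  next
    case False
    have "{i\<in>{1..N}. \<sigma> i = s \<and> (i \<in> P (\<sigma> i)) = a} = ?A s - P s"
      using False by auto
    moreover have "card (?A s - P s) = card (?A s) - card (P s)"
      using P(1)[of s] by (intro card_Diff_subset) (auto intro: finite_subset)
    ultimately show ?thesis using P(2)[of s] card_A[of s] False
      by (simp add: action_count_def)
  qed
  then show ?thesis by blast
qed

lemma action_count_arm_actions:
  assumes "\<And>s. (\<Sum>a\<in>UNIV. \<pi> N t (state_count N \<sigma>) s a) = state_count N \<sigma> s"
  shows "action_count N \<sigma> (arm_actions \<pi> N t \<sigma>) = \<pi> N t (state_count N \<sigma>)"
  unfolding arm_actions_def using someI_ex[OF ex_action_count[OF assms]] .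

definition next_states ::
    "'s::finite bandit \<Rightarrow> 's policy \<Rightarrow> nat \<Rightarrow> nat \<Rightarrow> (nat \<Rightarrow> 's) \<Rightarrow> (nat \<Rightarrow> 's) pmf" where
  "next_states B \<pi> N t \<sigma> =
     Pi_pmf {1..N} (init_state B) (\<lambda>i. trans B t (\<sigma> i) (arm_actions \<pi> N t \<sigma> i))"

text \<open>
  The law of the trajectory after \<open>n\<close> transitions: \<open>h t i\<close> is the state of arm \<open>i\<close> at time
  \<open>t\<close>, for \<open>t \<in> {1..n + 1}\<close>; later times carry a dummy value.
\<close>

primrec trajectory ::
    "'s::finite bandit \<Rightarrow> 's policy \<Rightarrow> nat \<Rightarrow> nat \<Rightarrow> (nat \<Rightarrow> nat \<Rightarrow> 's) pmf" where
  "trajectory B \<pi> N 0 = return_pmf (\<lambda>t i. init_state B)"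
| "trajectory B \<pi> N (Suc n) =
     bind_pmf (trajectory B \<pi> N n)
       (\<lambda>h. map_pmf (\<lambda>\<sigma>. h(n + 2 := \<sigma>)) (next_states B \<pi> N (n + 1) (h (n + 1))))"

definition total_reward :: "'s::finite bandit \<Rightarrow> 's policy \<Rightarrow> nat \<Rightarrow> nat \<Rightarrow> (nat \<Rightarrow> 's) \<Rightarrow> real" where
  "total_reward B \<pi> N t \<sigma> = (\<Sum>i=1..N. reward B t (\<sigma> i) (arm_actions \<pi> N t \<sigma> i))"

definition policy_value :: "'s::finite bandit \<Rightarrow> 's policy \<Rightarrow> nat \<Rightarrow> real" where
  "policy_value B \<pi> N =
     measure_pmf.expectation (trajectory B \<pi> N (horizon B - 1))
       (\<lambda>h. \<Sum>t=1..horizon B. total_reward B \<pi> N t (h t))"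

definition optimal_value :: "'s::finite bandit \<Rightarrow> nat \<Rightarrow> real" where
  "optimal_value B N = (SUP \<pi>\<in>{\<pi>. is_policy B \<pi>}. policy_value B \<pi> N)"


subsection \<open>Occupation measures and fluid consistency\<close>

definition occupation_measure :: "'s::finite bandit \<Rightarrow> (nat \<Rightarrow> 's \<Rightarrow> bool \<Rightarrow> real) \<Rightarrow> bool" where
  "occupation_measure B x \<longleftrightarrow>
     (\<forall>t\<in>{2..horizon B}. \<forall>s. (\<Sum>a\<in>UNIV. x t s a) =
        (\<Sum>a\<in>UNIV. \<Sum>s'\<in>UNIV. x (t - 1) s' a * pmf (trans B (t - 1) s' a) s)) \<and>
     (\<forall>t\<in>{1..horizon B}. (\<Sum>s\<in>UNIV. x t s True) = budget B t) \<and>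
     (\<Sum>a\<in>UNIV. x 1 (init_state B) a) = 1 \<and>
     (\<Sum>s\<in>UNIV. \<Sum>a\<in>UNIV. x 1 s a) = 1 \<and>
     (\<forall>t\<in>{1..horizon B}. \<forall>s a. 0 \<le> x t s a)"

definition lp_objective :: "'s::finite bandit \<Rightarrow> (nat \<Rightarrow> 's \<Rightarrow> bool \<Rightarrow> real) \<Rightarrow> real" where
  "lp_objective B x = (\<Sum>t=1..horizon B. \<Sum>s\<in>UNIV. \<Sum>a\<in>UNIV. reward B t s a * x t s a)"

definition optimal_occupation_measure ::
    "'s::finite bandit \<Rightarrow> (nat \<Rightarrow> 's \<Rightarrow> bool \<Rightarrow> real) \<Rightarrow> bool" where
  "optimal_occupation_measure B x \<longleftrightarrow>
     occupation_measure B x \<and>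
     (\<forall>y. occupation_measure B y \<longrightarrow> lp_objective B y \<le> lp_objective B x)"

definition fluid_consistent ::
    "'s::finite bandit \<Rightarrow> (nat \<Rightarrow> 's \<Rightarrow> bool \<Rightarrow> real) \<Rightarrow> 's policy \<Rightarrow> bool" where
  "fluid_consistent B x \<pi> \<longleftrightarrow>
     (\<forall>t\<in>{1..horizon B}. \<forall>Z :: nat \<Rightarrow> 's \<Rightarrow> nat.
        (\<forall>N. admissible B N \<longrightarrow> (\<Sum>s\<in>UNIV. Z N s) = N) \<longrightarrow>
        (\<forall>s. ((\<lambda>N. real (Z N s) / real N) \<longlongrightarrow> (\<Sum>a\<in>UNIV. x t s a)) (large_N B)) \<longrightarrow>
        (\<forall>s a. ((\<lambda>N. real (\<pi> N t (Z N) s a) / real N) \<longlongrightarrow> x t s a) (large_N B)))"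

end

theory Submission imports Defs begin

text \<open>
  The linear program is the fluid relaxation of the control problem, and it serves as the
  benchmark for every policy at once.

  Fix an admissible \<open>N\<close> and any policy \<open>\<rho>\<close>. The normalised expected action counts
  \<open>E X\<^sub>t(s, a) / N\<close> under \<open>\<rho>\<close> satisfy all constraints of the linear program: the budget and
  flow constraints hold for the counts (the latter in conditional expectation) and they are linear
  (\<open>occupation_measure_mean_actions\<close>). The value of \<open>\<rho>\<close> is \<open>N\<close> times the objective at this feasible
  point (\<open>policy_value_eq_lp_objective\<close>). Hence no policy earns more than \<open>N\<close> times the optimum
  of the program, and the optimality gap of \<open>\<pi>\<close>, divided by \<open>N\<close>, lies between \<open>0\<close> and the
  difference of the objective at \<open>x\<close> and at the mean action counts of \<open>\<pi>\<close>. It remains to see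
  that these mean action counts converge to \<open>x\<close> (\<open>mean_actions_tendsto\<close>).

  This is shown by induction on time, in the form that the random fractions \<open>Z\<^sub>t / N\<close> and \<open>X\<^sub>t / N\<close>
  converge in mean to \<open>z\<^sub>t\<close> and \<open>x\<^sub>t\<close>. From \<open>x\<^sub>t\<close> to \<open>z\<^bsub>t+1\<^esub>\<close> one uses that the arms move
  independently given the current states, so that the next state counts deviate by at most
  \<open>\<surd>N\<close> in mean from their conditional expectation (\<open>next_states_concentrate\<close>). From \<open>z\<^sub>t\<close> to
  \<open>x\<^sub>t\<close> one uses fluid consistency. It speaks of deterministic sequences only; to apply it to random
  state counts, one picks for each \<open>N\<close> the worst among the likely outcomes, which is again a
  deterministic sequence converging to \<open>z\<^sub>t\<close> (\<open>expectation_tendsto_0_if_selections\<close>).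
\<close>


section \<open>Expectations over finitely supported distributions\<close>

lemma integrable_finite_pmf [simp]:
  fixes f :: "'a \<Rightarrow> real"
  assumes "finite (set_pmf p)"
  shows "integrable (measure_pmf p) f"
  using assms by (rule integrable_measure_pmf_finite)

lemma expectation_finite_pmf:
  fixes f :: "'a \<Rightarrow> real"
  assumes "finite (set_pmf p)"
  shows "measure_pmf.expectation p f = (\<Sum>y\<in>set_pmf p. pmf p y * f y)"
  using integral_measure_pmf[OF assms, of p f] by simp

lemma expectation_bind_finite_pmf:
  fixes h :: "'b \<Rightarrow> real"
  assumes "finite (set_pmf p)" "\<And>y. finite (set_pmf (f y))"
  shows "measure_pmf.expectation (bind_pmf p f) h =
         measure_pmf.expectation p (\<lambda>y. measure_pmf.expectation (f y) h)"
  using assms by (subst pmf_expectation_bind[of "set_pmf p"]) (auto simp: expectation_finite_pmf)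

lemma expectation_mono_finite_pmf:
  fixes f g :: "'a \<Rightarrow> real"
  assumes "finite (set_pmf p)" "\<And>y. y \<in> set_pmf p \<Longrightarrow> f y \<le> g y"
  shows "measure_pmf.expectation p f \<le> measure_pmf.expectation p g"
  using assms by (intro integral_mono_AE) (auto simp: AE_measure_pmf_iff)

lemma abs_expectation_le:
  fixes f :: "'a \<Rightarrow> real"
  shows "\<bar>measure_pmf.expectation p f\<bar> \<le> measure_pmf.expectation p (\<lambda>y. \<bar>f y\<bar>)"
  by simp

lemma expectation_of_bool_eq: "measure_pmf.expectation p (\<lambda>y. of_bool (y = c)) = pmf p c"
proof -
  have "(\<lambda>y. of_bool (y = c) :: real) = indicator {c}" by (auto simp: indicator_def)
  then show ?thesis by (simp add: measure_pmf_single)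
qed

lemma ex_le_expectation:
  fixes d :: "'a \<Rightarrow> real"
  assumes fin: "finite (set_pmf p)"
  shows "\<exists>y\<in>set_pmf p. d y \<le> measure_pmf.expectation p d"
proof (rule ccontr)
  let ?m = "measure_pmf.expectation p d"
  assume "\<not> ?thesis"
  then have "0 < (\<Sum>y\<in>set_pmf p. pmf p y * (d y - ?m))"
    using fin by (intro sum_pos) (auto simp: set_pmf_not_empty pmf_positive not_le)
  also have "\<dots> = measure_pmf.expectation p (\<lambda>y. d y - ?m)"
    using fin by (simp only: expectation_finite_pmf)
  also have "\<dots> = 0"
    using fin by (subst Bochner_Integration.integral_diff) auto
  finally show False by simp
qed

text \<open>
  This transfers a statement about deterministic sequences to random ones. With \<open>m\<close> the mean of
  \<open>d\<close>, Markov's inequality makes \<open>d > m + \<surd>m\<close> an event of probability at most \<open>\<surd>m\<close>, where the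
  bound \<open>C\<close> on \<open>g\<close> suffices. The other outcomes form a finite set, nonempty since some outcome is
  at most the mean, on which \<open>g\<close> has a maximiser \<open>Y\<close>. As \<open>d i (Y i) \<le> m + \<surd>m\<close> tends to \<open>0\<close>,
  so does \<open>g i (Y i)\<close> by hypothesis, and it dominates \<open>g\<close> outside the rare event. Choosing the
  maximiser avoids extracting subsequences, so that any filter is allowed.
\<close>

lemma expectation_tendsto_0_if_selections:
  fixes p :: "'i \<Rightarrow> 'b pmf" and d g :: "'i \<Rightarrow> 'b \<Rightarrow> real"
  assumes fin: "\<And>i. finite (set_pmf (p i))"
    and d_nonneg: "\<And>i y. 0 \<le> d i y" and g_nonneg: "\<And>i y. 0 \<le> g i y"
    and g_le: "\<forall>\<^sub>F i in F. \<forall>y\<in>set_pmf (p i). g i y \<le> C"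
    and d_lim: "((\<lambda>i. measure_pmf.expectation (p i) (d i)) \<longlongrightarrow> 0) F"
    and sel: "\<And>Y. (\<And>i. Y i \<in> set_pmf (p i)) \<Longrightarrow> ((\<lambda>i. d i (Y i)) \<longlongrightarrow> 0) F \<Longrightarrow>
                ((\<lambda>i. g i (Y i)) \<longlongrightarrow> 0) F"
  shows "((\<lambda>i. measure_pmf.expectation (p i) (g i)) \<longlongrightarrow> 0) F"
proof -
  define m where "m i = measure_pmf.expectation (p i) (d i)" for i
  define \<delta> where "\<delta> i = m i + sqrt (m i)" for i
  define G where "G i = {y \<in> set_pmf (p i). d i y \<le> \<delta> i}" for i
  have m_nonneg: "0 \<le> m i" for i
    unfolding m_def by (rule Bochner_Integration.integral_nonneg) (rule d_nonneg)
  have "\<exists>y\<in>G i. \<forall>y'\<in>G i. g i y' \<le> g i y" for i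
  proof -
    obtain y where "y \<in> set_pmf (p i)" "d i y \<le> m i"
      using ex_le_expectation[OF fin] unfolding m_def by blast
    then have "y \<in> G i" using m_nonneg[of i] by (simp add: G_def \<delta>_def add_increasing2)
    moreover have "finite (G i)" unfolding G_def using fin by simp
    ultimately have "Max (g i ` G i) \<in> g i ` G i" by (intro Max_in) auto
    then obtain y' where "y' \<in> G i" "g i y' = Max (g i ` G i)" by force
    then show ?thesis using \<open>finite (G i)\<close> by (intro bexI[of _ y']) auto
  qed
  then obtain Y where Y: "\<And>i. Y i \<in> G i" "\<And>i y. y \<in> G i \<Longrightarrow> g i y \<le> g i (Y i)" by metis
  have \<delta>_lim: "(\<delta> \<longlongrightarrow> 0) F"
    using tendsto_add[OF d_lim tendsto_real_sqrt[OF d_lim]] unfolding \<delta>_def m_def by simp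
  have "((\<lambda>i. d i (Y i)) \<longlongrightarrow> 0) F"
    by (rule tendsto_sandwich[OF _ _ tendsto_const \<delta>_lim])
       (use Y(1) d_nonneg in \<open>auto simp: G_def\<close>)
  then have gY_lim: "((\<lambda>i. g i (Y i)) \<longlongrightarrow> 0) F"
    using Y(1) by (intro sel) (auto simp: G_def)
  have upper: "measure_pmf.expectation (p i) (g i) \<le> g i (Y i) + \<bar>C\<bar> * sqrt (m i)"
    if C: "\<forall>y\<in>set_pmf (p i). g i y \<le> C" for i
  proof -
    \<comment> \<open>Markov's inequality in pointwise form. If \<open>m i = 0\<close>, the quotient is \<open>0\<close> by convention; this
      is harmless, because then \<open>d i\<close> vanishes on the support, which therefore equals \<open>G i\<close>.\<close>
    have "g i y \<le> g i (Y i) + \<bar>C\<bar> / sqrt (m i) * d i y" if y: "y \<in> set_pmf (p i)" for y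
    proof (cases "y \<in> G i")
      case True
      then show ?thesis using Y(2)[of y i] m_nonneg[of i] d_nonneg[of i y]
        by (smt (verit) divide_nonneg_nonneg mult_nonneg_nonneg real_sqrt_ge_zero)
    next
      case False
      then have less: "m i + sqrt (m i) < d i y" using y by (simp add: G_def \<delta>_def)
      have "m i \<noteq> 0"
      proof
        assume "m i = 0"
        then have "(\<Sum>y\<in>set_pmf (p i). pmf (p i) y * d i y) = 0"
          using expectation_finite_pmf[OF fin] by (simp add: m_def)
        then have "d i y = 0"
          using y by (subst (asm) sum_nonneg_eq_0_iff) (use fin[of i] d_nonneg in \<open>auto simp: set_pmf_iff\<close>)
        then show False using less \<open>m i = 0\<close> by simp
      qed
      then have pos: "0 < sqrt (m i)" using m_nonneg[of i] by simp
      have "g i y \<le> \<bar>C\<bar> * 1" using C y by (smt (verit))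
      also have "\<dots> \<le> \<bar>C\<bar> * (d i y / sqrt (m i))"
        using less pos m_nonneg[of i] by (intro mult_left_mono) (auto simp: field_simps)
      finally show ?thesis using g_nonneg[of i "Y i"] by simp
    qed
    then have "measure_pmf.expectation (p i) (g i) \<le>
        measure_pmf.expectation (p i) (\<lambda>y. g i (Y i) + \<bar>C\<bar> / sqrt (m i) * d i y)"
      by (intro expectation_mono_finite_pmf fin)
    also have "\<dots> = g i (Y i) + \<bar>C\<bar> / sqrt (m i) * m i"
      using fin by (simp add: m_def)
    also have "\<dots> = g i (Y i) + \<bar>C\<bar> * sqrt (m i)"
      using real_div_sqrt[OF m_nonneg[of i]] by (metis times_divide_eq_left times_divide_eq_right)
    finally show ?thesis .
  qed
  have upper_lim: "((\<lambda>i. g i (Y i) + \<bar>C\<bar> * sqrt (m i)) \<longlongrightarrow> 0) F"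
    using tendsto_add[OF gY_lim tendsto_mult_left[OF tendsto_real_sqrt[OF d_lim], of "\<bar>C\<bar>"]]
    unfolding m_def by simp
  show ?thesis
    by (rule tendsto_sandwich[OF _ _ tendsto_const upper_lim])
       (use g_nonneg in \<open>auto intro!: Bochner_Integration.integral_nonneg eventually_mono[OF g_le] upper\<close>)
qed


section \<open>Weak law of large numbers\<close>

lemma finite_set_Pi_pmf:
  assumes "finite A" "\<And>i. i \<in> A \<Longrightarrow> finite (set_pmf (p i))"
  shows "finite (set_pmf (Pi_pmf A dflt p))"
  using assms by (auto simp: set_Pi_pmf intro!: finite_PiE_dflt)

text \<open>
  Adding one more coordinate to the sum leaves no cross term in the expected square, since the new
  summand is centred and independent of the others; so the second moments add up.
\<close>

lemma second_moment_Pi_pmf_le: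
  fixes g :: "'i \<Rightarrow> 'b \<Rightarrow> real"
  assumes "finite A"
    and "\<And>i. i \<in> A \<Longrightarrow> finite (set_pmf (p i))"
    and "\<And>i. i \<in> A \<Longrightarrow> measure_pmf.expectation (p i) (g i) = 0"
    and "\<And>i y. i \<in> A \<Longrightarrow> \<bar>g i y\<bar> \<le> 1"
  shows "measure_pmf.expectation (Pi_pmf A dflt p) (\<lambda>f. (\<Sum>i\<in>A. g i (f i))\<^sup>2) \<le> card A"
  using assms
proof (induction A rule: finite_induct)
  case empty
  then show ?case by simp
next
  case (insert x A)
  let ?S = "\<lambda>f. \<Sum>i\<in>A. g i (f i)"
  let ?P = "Pi_pmf A dflt p"
  have fin: "finite (set_pmf ?P)" "finite (set_pmf (p x))"
    using insert by (auto intro: finite_set_Pi_pmf)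
  have "(\<Sum>i\<in>insert x A. g i ((f(x := y)) i)) = g x y + ?S f" for f y
    using insert.hyps by (simp add: sum.insert) (intro sum.cong, auto)
  then have "measure_pmf.expectation (Pi_pmf (insert x A) dflt p) (\<lambda>f. (\<Sum>i\<in>insert x A. g i (f i))\<^sup>2)
      = measure_pmf.expectation (p x) (\<lambda>y. measure_pmf.expectation ?P (\<lambda>f. (g x y + ?S f)\<^sup>2))"
    using insert.hyps fin
    by (simp add: Pi_pmf_insert' expectation_bind_finite_pmf del: fun_upd_apply)
  also have "\<dots> = measure_pmf.expectation (p x) (\<lambda>y. (g x y)\<^sup>2 +
      2 * measure_pmf.expectation ?P ?S * g x y + measure_pmf.expectation ?P (\<lambda>f. (?S f)\<^sup>2))"
    using fin by (simp add: power2_sum algebra_simps)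
  also have "\<dots> = measure_pmf.expectation (p x) (\<lambda>y. (g x y)\<^sup>2) +
      measure_pmf.expectation ?P (\<lambda>f. (?S f)\<^sup>2)"
    using fin insert.prems(2)[of x] by simp
  also have "\<dots> \<le> measure_pmf.expectation (p x) (\<lambda>y. 1) + card A"
    using insert fin
    by (intro add_mono expectation_mono_finite_pmf) (auto simp: abs_square_le_1)
  also have "\<dots> = card (insert x A)" using insert.hyps by simp
  finally show ?case .
qed

text \<open>
  The square of the mean of a random variable is at most its second moment, since the variance,
  here that of the absolute value of the sum, is nonnegative.
\<close>

lemma mean_deviation_Pi_pmf_le:
  fixes g :: "'i \<Rightarrow> 'b \<Rightarrow> real"
  assumes "finite A"
    and fin: "\<And>i. i \<in> A \<Longrightarrow> finite (set_pmf (p i))"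
    and "\<And>i. i \<in> A \<Longrightarrow> measure_pmf.expectation (p i) (g i) = 0"
    and "\<And>i y. i \<in> A \<Longrightarrow> \<bar>g i y\<bar> \<le> 1"
  shows "measure_pmf.expectation (Pi_pmf A dflt p) (\<lambda>f. \<bar>\<Sum>i\<in>A. g i (f i)\<bar>) \<le> sqrt (card A)"
proof -
  let ?S = "\<lambda>f. \<bar>\<Sum>i\<in>A. g i (f i)\<bar>" and ?P = "Pi_pmf A dflt p"
  have finP: "finite (set_pmf ?P)" using assms by (intro finite_set_Pi_pmf)
  have "0 \<le> measure_pmf.expectation ?P (\<lambda>f. (?S f - measure_pmf.expectation ?P ?S)\<^sup>2)"
    by (rule Bochner_Integration.integral_nonneg) simp
  also have "\<dots> = measure_pmf.expectation ?P (\<lambda>f. (?S f)\<^sup>2) - (measure_pmf.expectation ?P ?S)\<^sup>2"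
    using finP by (intro measure_pmf.variance_eq) simp_all
  finally have "(measure_pmf.expectation ?P ?S)\<^sup>2 \<le>
      measure_pmf.expectation ?P (\<lambda>f. (\<Sum>i\<in>A. g i (f i))\<^sup>2)"
    by simp
  also have "\<dots> \<le> card A" using assms by (rule second_moment_Pi_pmf_le)
  finally have "(measure_pmf.expectation ?P ?S)\<^sup>2 \<le> card A" .
  then show ?thesis by (rule real_le_rsqrt)
qed


section \<open>The law of the arms\<close>

text \<open>
  The marginal of the trajectory after \<open>n\<close> transitions, that is, at time \<open>n + 1\<close>. The actions depend
  on the current joint state only, so these marginals obey a recursion of their own.
\<close>

primrec arms_law :: "'s::finite bandit \<Rightarrow> 's policy \<Rightarrow> nat \<Rightarrow> nat \<Rightarrow> (nat \<Rightarrow> 's) pmf" where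
  "arms_law B \<pi> N 0 = return_pmf (\<lambda>i. init_state B)"
| "arms_law B \<pi> N (Suc n) = bind_pmf (arms_law B \<pi> N n) (next_states B \<pi> N (Suc n))"

lemma finite_next_states [simp]: "finite (set_pmf (next_states B \<pi> N t \<sigma>))"
  unfolding next_states_def by (intro finite_set_Pi_pmf) (auto intro: finite_subset[OF subset_UNIV])

lemma finite_arms_law [simp]: "finite (set_pmf (arms_law B \<pi> N n))"
  by (induction n) auto

lemma finite_trajectory [simp]: "finite (set_pmf (trajectory B \<pi> N n))"
  by (induction n) auto

lemma map_trajectory:
  "n \<le> m \<Longrightarrow> map_pmf (\<lambda>h. h (Suc n)) (trajectory B \<pi> N m) = arms_law B \<pi> N n"
proof (induction m arbitrary: n)
  case 0
  then show ?case by simp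
next
  case (Suc m)
  show ?case
  proof (cases "n = Suc m")
    case True
    then show ?thesis
      by (simp add: map_bind_pmf pmf.map_comp o_def Suc.IH[OF order_refl, symmetric] bind_map_pmf)
  next
    case False
    then show ?thesis using Suc
      by (simp add: map_bind_pmf pmf.map_comp o_def map_pmf_const bind_return_pmf' flip: map_pmf_def)
  qed
qed

text \<open>
  Rewards and transition probabilities of an arm depend only on its state and action. Grouping the
  arms accordingly eliminates the arbitrary choice of the pulled arms made by \<^const>\<open>arm_actions\<close>.
\<close>

lemma sum_over_arms:
  fixes f :: "'s::finite \<Rightarrow> bool \<Rightarrow> real"
  shows "(\<Sum>i=1..N. f (\<sigma> i) (act i)) = (\<Sum>s\<in>UNIV. \<Sum>a\<in>UNIV. f s a * action_count N \<sigma> act s a)"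
proof -
  have "f s a * action_count N \<sigma> act s a = (\<Sum>i=1..N. if \<sigma> i = s \<and> act i = a then f s a else 0)"
    for s a
    unfolding action_count_def by (simp add: sum.If_cases Int_def mult.commute)
  then have "(\<Sum>s\<in>UNIV. \<Sum>a\<in>UNIV. f s a * action_count N \<sigma> act s a) =
      (\<Sum>s\<in>UNIV. \<Sum>a\<in>UNIV. \<Sum>i=1..N. if \<sigma> i = s \<and> act i = a then f s a else 0)"
    by simp
  also have "\<dots> = (\<Sum>i=1..N. \<Sum>s\<in>UNIV. \<Sum>a\<in>UNIV. if \<sigma> i = s \<and> act i = a then f s a else 0)"
    by (subst (2) sum.swap, subst sum.swap) simp
  also have "\<dots> = (\<Sum>i=1..N. f (\<sigma> i) (act i))"
  proof (rule sum.cong[OF refl])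
    fix i
    have "(\<Sum>s\<in>UNIV. \<Sum>a\<in>UNIV. if \<sigma> i = s \<and> act i = a then f s a else 0) =
        (\<Sum>s\<in>UNIV. if \<sigma> i = s then f s (act i) else 0)"
      by (intro sum.cong) (auto simp: sum.delta')
    then show "(\<Sum>s\<in>UNIV. \<Sum>a\<in>UNIV. if \<sigma> i = s \<and> act i = a then f s a else 0) = f (\<sigma> i) (act i)"
      by (simp add: sum.delta')
  qed
  finally show ?thesis by simp
qed

lemma sum_state_count: "(\<Sum>s\<in>UNIV. state_count N (\<sigma> :: nat \<Rightarrow> 's::finite) s) = N"
proof -
  have "(\<Sum>s\<in>UNIV. card {i\<in>{1..N}. \<sigma> i = s}) = card (\<Union>s. {i\<in>{1..N}. \<sigma> i = s})"
    by (rule card_UN_disjoint[symmetric]) auto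
  also have "(\<Union>s. {i\<in>{1..N}. \<sigma> i = s}) = {1..N}" by auto
  finally show ?thesis by (simp add: state_count_def)
qed

lemma state_count_eq_sum:
  "real (state_count N \<sigma> s) = (\<Sum>i=1..N. of_bool (\<sigma> i = s))"
  by (simp add: state_count_def of_bool_def sum.If_cases Int_def)

context
  fixes B :: "'s::finite bandit" and \<pi> :: "'s policy" and N t :: nat
  assumes policy: "is_policy B \<pi>" and adm: "admissible B N" and t: "t \<in> {1..horizon B}"
begin

lemma policy_sum_actions: "(\<Sum>a\<in>UNIV. \<pi> N t (state_count N \<sigma>) s a) = state_count N \<sigma> s"
  using policy adm t sum_state_count unfolding is_policy_def by blast

lemma policy_sum_pulled:
  "(\<Sum>s\<in>UNIV. real (\<pi> N t (state_count N \<sigma>) s True)) = budget B t * N"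
  using policy adm t sum_state_count unfolding is_policy_def of_nat_sum by blast

lemma policy_le: "\<pi> N t (state_count N \<sigma>) s a \<le> N"
proof -
  have "\<pi> N t (state_count N \<sigma>) s a \<le> (\<Sum>a\<in>UNIV. \<pi> N t (state_count N \<sigma>) s a)"
    by (intro member_le_sum) auto
  also have "\<dots> = state_count N \<sigma> s" by (rule policy_sum_actions)
  also have "\<dots> \<le> (\<Sum>s\<in>UNIV. state_count N \<sigma> s)" by (intro member_le_sum) auto
  finally show ?thesis by (simp add: sum_state_count)
qed

lemma action_count_policy: "action_count N \<sigma> (arm_actions \<pi> N t \<sigma>) = \<pi> N t (state_count N \<sigma>)"
  by (intro action_count_arm_actions policy_sum_actions)

lemma total_reward_policy:
  "total_reward B \<pi> N t \<sigma> =
     (\<Sum>s\<in>UNIV. \<Sum>a\<in>UNIV. reward B t s a * \<pi> N t (state_count N \<sigma>) s a)"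
  unfolding total_reward_def sum_over_arms action_count_policy ..

text \<open>
  The law of large numbers for one transition: the next state count is a sum of independent
  indicators, and centring each of them subtracts the sum on the right.
\<close>

lemma next_states_concentrate:
  "measure_pmf.expectation (next_states B \<pi> N t \<sigma>)
     (\<lambda>\<sigma>'. \<bar>real (state_count N \<sigma>' s') -
        (\<Sum>s\<in>UNIV. \<Sum>a\<in>UNIV. pmf (trans B t s a) s' * \<pi> N t (state_count N \<sigma>) s a)\<bar>) \<le> sqrt N"
proof -
  let ?q = "\<lambda>i. trans B t (\<sigma> i) (arm_actions \<pi> N t \<sigma> i)"
  define g where "g i y = of_bool (y = s') - pmf (?q i) s'" for i y
  have fin: "finite (set_pmf (q :: 's pmf))" for q by (rule finite_subset[OF subset_UNIV]) simp
  have centered: "measure_pmf.expectation (?q i) (g i) = 0" for i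
    unfolding g_def using fin by (simp add: expectation_of_bool_eq)
  have "real (state_count N \<sigma>' s') -
        (\<Sum>s\<in>UNIV. \<Sum>a\<in>UNIV. pmf (trans B t s a) s' * \<pi> N t (state_count N \<sigma>) s a) =
      (\<Sum>i\<in>{1..N}. g i (\<sigma>' i))" for \<sigma>'
    unfolding state_count_eq_sum action_count_policy[symmetric]
      sum_over_arms[of "\<lambda>s a. pmf (trans B t s a) s'", symmetric]
    by (simp add: g_def sum_subtractf)
  moreover have "\<bar>g i y\<bar> \<le> 1" for i y
    using pmf_le_1[of "?q i" s'] by (auto simp: g_def abs_le_iff intro: order_trans[OF _ pmf_nonneg])
  ultimately show ?thesis
    using mean_deviation_Pi_pmf_le[of "{1..N}" ?q g "init_state B"] fin centered
    by (simp add: next_states_def)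
qed

lemma expectation_next_states:
  "measure_pmf.expectation (next_states B \<pi> N t \<sigma>) (\<lambda>\<sigma>'. real (state_count N \<sigma>' s')) =
     (\<Sum>s\<in>UNIV. \<Sum>a\<in>UNIV. pmf (trans B t s a) s' * \<pi> N t (state_count N \<sigma>) s a)"
proof -
  let ?q = "\<lambda>i. trans B t (\<sigma> i) (arm_actions \<pi> N t \<sigma> i)"
  have "measure_pmf.expectation (next_states B \<pi> N t \<sigma>) (\<lambda>\<sigma>'. of_bool (\<sigma>' i = s')) = pmf (?q i) s'"
    if i: "i \<in> {1..N}" for i
  proof -
    have "measure_pmf.expectation (next_states B \<pi> N t \<sigma>) (\<lambda>\<sigma>'. of_bool (\<sigma>' i = s') :: real) =
        measure_pmf.expectation (map_pmf (\<lambda>\<sigma>'. \<sigma>' i) (next_states B \<pi> N t \<sigma>)) (\<lambda>y. of_bool (y = s') :: real)"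
      by simp
    also have "map_pmf (\<lambda>\<sigma>'. \<sigma>' i) (next_states B \<pi> N t \<sigma>) = ?q i"
      using i unfolding next_states_def by (subst Pi_pmf_component) auto
    finally show ?thesis unfolding expectation_of_bool_eq .
  qed
  then have "measure_pmf.expectation (next_states B \<pi> N t \<sigma>) (\<lambda>\<sigma>'. real (state_count N \<sigma>' s')) =
      (\<Sum>i=1..N. pmf (?q i) s')"
    unfolding state_count_eq_sum by (subst Bochner_Integration.integral_sum) auto
  then show ?thesis
    unfolding action_count_policy[symmetric]
      sum_over_arms[of "\<lambda>s a. pmf (trans B t s a) s'", symmetric] .
qed

end


section \<open>The linear program bounds every policy\<close>

text \<open>The shift by one matches \<^const>\<open>arms_law\<close>, whose argument counts transitions.\<close>

definition mean_actions :: "'s::finite bandit \<Rightarrow> 's policy \<Rightarrow> nat \<Rightarrow> nat \<Rightarrow> 's \<Rightarrow> bool \<Rightarrow> real" where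
  "mean_actions B \<pi> N t s a =
     measure_pmf.expectation (arms_law B \<pi> N (t - 1))
       (\<lambda>\<sigma>. real (\<pi> N t (state_count N \<sigma>) s a) / real N)"

lemma sum_mean_actions:
  assumes "is_policy B \<pi>" "admissible B N" "t \<in> {1..horizon B}"
  shows "(\<Sum>a\<in>UNIV. mean_actions B \<pi> N t s a) =
    measure_pmf.expectation (arms_law B \<pi> N (t - 1)) (\<lambda>\<sigma>. real (state_count N \<sigma> s)) / N"
proof -
  have "(\<Sum>a\<in>UNIV. mean_actions B \<pi> N t s a) =
      measure_pmf.expectation (arms_law B \<pi> N (t - 1))
        (\<lambda>\<sigma>. (\<Sum>a\<in>UNIV. real (\<pi> N t (state_count N \<sigma>) s a)) / N)"
    unfolding mean_actions_def sum_divide_distrib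
    by (subst Bochner_Integration.integral_sum) auto
  then show ?thesis
    by (simp add: policy_sum_actions[OF assms] flip: of_nat_sum)
qed

text \<open>
  Every constraint holds exactly, for each admissible \<open>N\<close>: it is linear in the action counts, so
  taking expectations preserves it. The flow constraint comes from averaging the next state counts
  first conditionally on the current states, and then over these.
\<close>

lemma occupation_measure_mean_actions:
  assumes valid: "valid_bandit B" and policy: "is_policy B \<pi>" and adm: "admissible B N"
  shows "occupation_measure B (mean_actions B \<pi> N)"
  unfolding occupation_measure_def
proof (intro conjI ballI allI)
  fix t s' assume t: "t \<in> {2..horizon B}"
  then obtain n where n: "t = Suc (Suc n)" by (cases t; cases "t - 1") auto
  have t': "Suc n \<in> {1..horizon B}" "t \<in> {1..horizon B}" using t n by auto
  have "(\<Sum>a\<in>UNIV. mean_actions B \<pi> N t s' a) =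
      measure_pmf.expectation (arms_law B \<pi> N n) (\<lambda>\<sigma>. (\<Sum>s\<in>UNIV. \<Sum>a\<in>UNIV.
        pmf (trans B (Suc n) s a) s' * \<pi> N (Suc n) (state_count N \<sigma>) s a) / N)"
    unfolding sum_mean_actions[OF policy adm t'(2)]
    by (simp add: n expectation_bind_finite_pmf expectation_next_states[OF policy adm t'(1)])
  also have "\<dots> = measure_pmf.expectation (arms_law B \<pi> N n) (\<lambda>\<sigma>. \<Sum>s\<in>UNIV. \<Sum>a\<in>UNIV.
        \<pi> N (Suc n) (state_count N \<sigma>) s a / N * pmf (trans B (Suc n) s a) s')"
    by (simp add: sum_divide_distrib mult.commute)
  also have "\<dots> = (\<Sum>s\<in>UNIV. \<Sum>a\<in>UNIV. mean_actions B \<pi> N (Suc n) s a * pmf (trans B (Suc n) s a) s')"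
    by (simp add: Bochner_Integration.integral_sum mean_actions_def)
  finally show "(\<Sum>a\<in>UNIV. mean_actions B \<pi> N t s' a) =
      (\<Sum>a\<in>UNIV. \<Sum>s\<in>UNIV. mean_actions B \<pi> N (t - 1) s a * pmf (trans B (t - 1) s a) s')"
    by (subst sum.swap) (simp add: n)
next
  have N: "0 < N" using adm by (simp add: admissible_def)
  fix t assume t: "t \<in> {1..horizon B}"
  have "(\<Sum>s\<in>UNIV. mean_actions B \<pi> N t s True) =
      measure_pmf.expectation (arms_law B \<pi> N (t - 1))
        (\<lambda>\<sigma>. (\<Sum>s\<in>UNIV. real (\<pi> N t (state_count N \<sigma>) s True)) / N)"
    unfolding mean_actions_def sum_divide_distrib
    by (subst Bochner_Integration.integral_sum) auto
  then show "(\<Sum>s\<in>UNIV. mean_actions B \<pi> N t s True) = budget B t"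
    using N by (simp add: policy_sum_pulled[OF policy adm t])
next
  have N: "0 < N" using adm by (simp add: admissible_def)
  have one: "1 \<in> {1..horizon B}" using valid by (simp add: valid_bandit_def)
  show "(\<Sum>a\<in>UNIV. mean_actions B \<pi> N 1 (init_state B) a) = 1"
    using N by (subst sum_mean_actions[OF policy adm one]) (simp add: state_count_eq_sum)
  show "(\<Sum>s\<in>UNIV. \<Sum>a\<in>UNIV. mean_actions B \<pi> N 1 s a) = 1"
    using N by (subst sum_mean_actions[OF policy adm one])
      (simp add: sum_state_count flip: sum_divide_distrib of_nat_sum)
next
  fix t s a
  show "0 \<le> mean_actions B \<pi> N t s a"
    unfolding mean_actions_def by (rule Bochner_Integration.integral_nonneg) simp
qed

lemma policy_value_eq_lp_objective:
  assumes policy: "is_policy B \<pi>" and adm: "admissible B N"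
  shows "policy_value B \<pi> N = real N * lp_objective B (mean_actions B \<pi> N)"
proof -
  have N: "0 < N" using adm by (simp add: admissible_def)
  have "policy_value B \<pi> N = (\<Sum>t=1..horizon B.
      measure_pmf.expectation (trajectory B \<pi> N (horizon B - 1)) (\<lambda>h. total_reward B \<pi> N t (h t)))"
    unfolding policy_value_def by (subst Bochner_Integration.integral_sum) auto
  also have "\<dots> = (\<Sum>t=1..horizon B.
      real N * (\<Sum>s\<in>UNIV. \<Sum>a\<in>UNIV. reward B t s a * mean_actions B \<pi> N t s a))"
  proof (rule sum.cong[OF refl])
    fix t assume t: "t \<in> {1..horizon B}"
    have "measure_pmf.expectation (trajectory B \<pi> N (horizon B - 1)) (\<lambda>h. total_reward B \<pi> N t (h t))
        = measure_pmf.expectation (map_pmf (\<lambda>h. h (Suc (t - 1))) (trajectory B \<pi> N (horizon B - 1)))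
            (total_reward B \<pi> N t)"
      using t by simp
    also have "\<dots> = measure_pmf.expectation (arms_law B \<pi> N (t - 1)) (total_reward B \<pi> N t)"
      using t by (subst map_trajectory) auto
    also have "\<dots> = measure_pmf.expectation (arms_law B \<pi> N (t - 1)) (\<lambda>\<sigma>. \<Sum>s\<in>UNIV. \<Sum>a\<in>UNIV.
        reward B t s a * (real N * (\<pi> N t (state_count N \<sigma>) s a / real N)))"
      using N by (simp add: total_reward_policy[OF policy adm t, abs_def])
    also have "\<dots> = (\<Sum>s\<in>UNIV. \<Sum>a\<in>UNIV. reward B t s a * (real N * mean_actions B \<pi> N t s a))"
      unfolding mean_actions_def
      by (simp only: Bochner_Integration.integral_sum integrable_finite_pmf finite_arms_law
          Bochner_Integration.integral_mult_right)
    finally show "measure_pmf.expectation (trajectory B \<pi> N (horizon B - 1))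
        (\<lambda>h. total_reward B \<pi> N t (h t)) =
        real N * (\<Sum>s\<in>UNIV. \<Sum>a\<in>UNIV. reward B t s a * mean_actions B \<pi> N t s a)"
      by (simp add: sum_distrib_left mult.left_commute)
  qed
  finally show ?thesis unfolding lp_objective_def sum_distrib_left .
qed

lemma policy_value_le_lp_optimum:
  assumes "valid_bandit B" "optimal_occupation_measure B x" "is_policy B \<pi>" "admissible B N"
  shows "policy_value B \<pi> N \<le> real N * lp_objective B x"
  using assms occupation_measure_mean_actions[of B \<pi> N]
  by (simp add: policy_value_eq_lp_objective optimal_occupation_measure_def mult_left_mono)


section \<open>A fluid consistent policy follows the occupation measure\<close>

lemma eventually_admissible: "\<forall>\<^sub>F N in large_N B. admissible B N"
  unfolding large_N_def by (simp add: eventually_inf_principal)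

lemma tendsto_inverse_sqrt_large_N: "((\<lambda>N. 1 / sqrt (real N)) \<longlongrightarrow> 0) (large_N B)"
proof -
  have "((\<lambda>N. 1 / sqrt (real N)) \<longlongrightarrow> 0) sequentially"
    by (intro tendsto_divide_0[OF tendsto_const] filterlim_at_top_imp_at_infinity
        filterlim_compose[OF sqrt_at_top filterlim_real_sequentially])
  then show ?thesis unfolding large_N_def by (rule tendsto_mono[OF inf_le1])
qed

context
  fixes B :: "'s::finite bandit" and x :: "nat \<Rightarrow> 's \<Rightarrow> bool \<Rightarrow> real" and \<pi> :: "'s policy"
  assumes valid: "valid_bandit B" and occ: "occupation_measure B x"
    and policy: "is_policy B \<pi>" and fluid: "fluid_consistent B x \<pi>"
begin

text \<open>
  Both errors are measured after \<open>n\<close> transitions, against the components of \<open>x\<close> at time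
  \<open>n + 1\<close>. Mean absolute deviations are used instead of convergence in probability because they
  add up over states and actions and pass through the linear dynamics without any \<open>\<epsilon>\<close>.
\<close>

definition state_error :: "nat \<Rightarrow> 's \<Rightarrow> nat \<Rightarrow> real" where
  "state_error n s N = measure_pmf.expectation (arms_law B \<pi> N n)
     (\<lambda>\<sigma>. \<bar>state_count N \<sigma> s / real N - (\<Sum>a\<in>UNIV. x (Suc n) s a)\<bar>)"

definition action_error :: "nat \<Rightarrow> 's \<Rightarrow> bool \<Rightarrow> nat \<Rightarrow> real" where
  "action_error n s a N = measure_pmf.expectation (arms_law B \<pi> N n)
     (\<lambda>\<sigma>. \<bar>\<pi> N (Suc n) (state_count N \<sigma>) s a / real N - x (Suc n) s a\<bar>)"

text \<open>
  At time \<open>1\<close> there is no error at all: nonnegativity and the two normalisations of \<open>x\<close> at time \<open>1\<close>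
  force its entire mass onto the initial state, where all arms are.
\<close>

lemma state_error_0: "(state_error 0 s \<longlongrightarrow> 0) (large_N B)"
proof (rule tendsto_eventually, rule eventually_mono[OF eventually_admissible])
  fix N assume "admissible B N"
  then have N: "0 < N" by (simp add: admissible_def)
  have one: "1 \<in> {1..horizon B}" using valid by (simp add: valid_bandit_def)
  have init: "(\<Sum>a\<in>UNIV. x 1 (init_state B) a) = 1" and total: "(\<Sum>s\<in>UNIV. \<Sum>a\<in>UNIV. x 1 s a) = 1"
    and nonneg: "\<And>s a. 0 \<le> x 1 s a"
    using occ one unfolding occupation_measure_def by blast+
  have "(\<Sum>s\<in>UNIV. \<Sum>a\<in>UNIV. x 1 s a) =
      (\<Sum>a\<in>UNIV. x 1 (init_state B) a) + (\<Sum>s\<in>UNIV - {init_state B}. \<Sum>a\<in>UNIV. x 1 s a)"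
    by (intro sum.remove) auto
  then have "(\<Sum>s\<in>UNIV - {init_state B}. \<Sum>a\<in>UNIV. x 1 s a) = 0" using init total by simp
  then have "(\<Sum>a\<in>UNIV. x 1 s a) = 0" if "s \<noteq> init_state B"
    using that by (subst (asm) sum_nonneg_eq_0_iff) (auto intro!: sum_nonneg nonneg[unfolded One_nat_def])
  then have "(\<Sum>a\<in>UNIV. x 1 s a) = of_bool (s = init_state B)" using init by auto
  then show "state_error 0 s N = 0"
    using N by (auto simp: state_error_def state_count_eq_sum)
qed

text \<open>
  Fluid consistency enters here. The selected outcomes are possible joint states of \<open>N\<close> arms, so
  their state counts add up to \<open>N\<close>, as the definition of fluid consistency requires.
\<close>

lemma action_error_tendsto_0:
  assumes n: "Suc n \<in> {1..horizon B}" and state: "\<And>s. (state_error n s \<longlongrightarrow> 0) (large_N B)"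
  shows "(action_error n s a \<longlongrightarrow> 0) (large_N B)"
proof -
  let ?Z = "\<lambda>N \<sigma> s. state_count N \<sigma> s / real N" and ?z = "\<lambda>s. \<Sum>a\<in>UNIV. x (Suc n) s a"
  let ?d = "\<lambda>N \<sigma>. \<Sum>s\<in>UNIV. \<bar>?Z N \<sigma> s - ?z s\<bar>"
  let ?g = "\<lambda>N \<sigma>. \<bar>\<pi> N (Suc n) (state_count N \<sigma>) s a / real N - x (Suc n) s a\<bar>"
  have "((\<lambda>N. measure_pmf.expectation (arms_law B \<pi> N n) (?g N)) \<longlongrightarrow> 0) (large_N B)"
  proof (rule expectation_tendsto_0_if_selections[where d = ?d and C = "1 + \<bar>x (Suc n) s a\<bar>"])
    show "\<forall>\<^sub>F N in large_N B. \<forall>\<sigma>\<in>set_pmf (arms_law B \<pi> N n). ?g N \<sigma> \<le> 1 + \<bar>x (Suc n) s a\<bar>"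
    proof (rule eventually_mono[OF eventually_admissible], intro ballI)
      fix N \<sigma> assume adm: "admissible B N"
      have "\<pi> N (Suc n) (state_count N \<sigma>) s a / real N \<le> 1"
        using policy_le[OF policy adm n, of \<sigma> s a] adm
        by (simp add: divide_le_eq_1 admissible_def)
      moreover have "0 \<le> \<pi> N (Suc n) (state_count N \<sigma>) s a / real N" by simp
      ultimately show "?g N \<sigma> \<le> 1 + \<bar>x (Suc n) s a\<bar>" by linarith
    qed
    have "((\<lambda>N. \<Sum>s\<in>UNIV. state_error n s N) \<longlongrightarrow> (\<Sum>s\<in>(UNIV :: 's set). 0)) (large_N B)"
      by (intro tendsto_sum state)
    then show "((\<lambda>N. measure_pmf.expectation (arms_law B \<pi> N n) (?d N)) \<longlongrightarrow> 0) (large_N B)"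
      by (simp add: state_error_def Bochner_Integration.integral_sum)
    fix Y :: "nat \<Rightarrow> nat \<Rightarrow> 's"
    assume lim: "((\<lambda>N. ?d N (Y N)) \<longlongrightarrow> 0) (large_N B)"
    have "((\<lambda>N. ?Z N (Y N) s) \<longlongrightarrow> ?z s) (large_N B)" for s
    proof -
      have "((\<lambda>N. ?Z N (Y N) s - ?z s) \<longlongrightarrow> 0) (large_N B)"
        by (rule tendsto_rabs_zero_cancel, rule tendsto_sandwich[OF _ _ tendsto_const lim])
           (auto intro!: always_eventually member_le_sum[where f = "\<lambda>s. \<bar>?Z _ (Y _) s - ?z s\<bar>"])
      then show ?thesis by (rule LIM_zero_cancel)
    qed
    then have "((\<lambda>N. \<pi> N (Suc n) (state_count N (Y N)) s a / real N) \<longlongrightarrow> x (Suc n) s a) (large_N B)"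
      by (intro fluid[unfolded fluid_consistent_def, rule_format, of "Suc n" "\<lambda>N. state_count N (Y N)"]
          n sum_state_count)
    then show "((\<lambda>N. ?g N (Y N)) \<longlongrightarrow> 0) (large_N B)"
      by (intro tendsto_rabs_zero LIM_zero)
  qed (auto intro: sum_nonneg)
  then show ?thesis by (simp add: action_error_def [abs_def])
qed

text \<open>
  The error splits into the random fluctuation of one transition, at most \<open>\<surd>N / N\<close> in mean, and the
  propagated action errors, since \<open>x\<close> follows the same linear flow as the conditional expectation
  of the state counts.
\<close>

lemma state_error_Suc:
  assumes n: "Suc (Suc n) \<in> {1..horizon B}"
    and action: "\<And>s a. (action_error n s a \<longlongrightarrow> 0) (large_N B)"
  shows "(state_error (Suc n) s' \<longlongrightarrow> 0) (large_N B)"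
proof -
  let ?z = "\<Sum>a\<in>UNIV. x (Suc (Suc n)) s' a"
  let ?P = "\<lambda>s a. pmf (trans B (Suc n) s a) s'"
  let ?X = "\<lambda>N \<sigma> s a. real (\<pi> N (Suc n) (state_count N \<sigma>) s a)"
  let ?bound = "\<lambda>N. 1 / sqrt (real N) + (\<Sum>s\<in>UNIV. \<Sum>a\<in>UNIV. ?P s a * action_error n s a N)"
  have n': "Suc n \<in> {1..horizon B}" using n by auto
  have "\<forall>s'. (\<Sum>a\<in>UNIV. x (Suc (Suc n)) s' a) =
      (\<Sum>a\<in>UNIV. \<Sum>s\<in>UNIV. x (Suc n) s a * pmf (trans B (Suc n) s a) s')"
    using occ n unfolding occupation_measure_def by (auto dest!: bspec[of _ _ "Suc (Suc n)"])
  then have flow: "?z = (\<Sum>s\<in>UNIV. \<Sum>a\<in>UNIV. ?P s a * x (Suc n) s a)"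
    by (subst sum.swap) (simp add: mult.commute)
  have "state_error (Suc n) s' N \<le> ?bound N" if adm: "admissible B N" for N
  proof -
    have N: "0 < real N" using adm by (simp add: admissible_def)
    let ?M = "\<lambda>\<sigma>. \<Sum>s\<in>UNIV. \<Sum>a\<in>UNIV. ?P s a * ?X N \<sigma> s a"
    let ?D = "\<lambda>\<sigma>. \<Sum>s\<in>UNIV. \<Sum>a\<in>UNIV. ?P s a * \<bar>?X N \<sigma> s a / N - x (Suc n) s a\<bar>"
    have step: "\<bar>state_count N \<sigma>' s' / real N - ?z\<bar> \<le>
        \<bar>real (state_count N \<sigma>' s') - ?M \<sigma>\<bar> / N + ?D \<sigma>" for \<sigma> \<sigma>'
    proof -
      have "?M \<sigma> / N - ?z = (\<Sum>s\<in>UNIV. \<Sum>a\<in>UNIV. ?P s a * (?X N \<sigma> s a / N - x (Suc n) s a))"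
        unfolding flow by (simp add: sum_subtractf sum_divide_distrib right_diff_distrib)
      also have "\<bar>\<dots>\<bar> \<le> ?D \<sigma>"
        by (intro order_trans[OF sum_abs] sum_mono) (simp add: abs_mult)
      finally have "\<bar>?M \<sigma> / N - ?z\<bar> \<le> ?D \<sigma>" .
      moreover have "\<bar>real (state_count N \<sigma>' s') - ?M \<sigma>\<bar> / N =
          \<bar>state_count N \<sigma>' s' / real N - ?M \<sigma> / N\<bar>"
        using N by (simp flip: diff_divide_distrib)
      ultimately show ?thesis by linarith
    qed
    have "measure_pmf.expectation (next_states B \<pi> N (Suc n) \<sigma>)
        (\<lambda>\<sigma>'. \<bar>state_count N \<sigma>' s' / real N - ?z\<bar>) \<le> 1 / sqrt N + ?D \<sigma>" for \<sigma>
    proof -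
      have "measure_pmf.expectation (next_states B \<pi> N (Suc n) \<sigma>)
          (\<lambda>\<sigma>'. \<bar>state_count N \<sigma>' s' / real N - ?z\<bar>) \<le>
        measure_pmf.expectation (next_states B \<pi> N (Suc n) \<sigma>)
          (\<lambda>\<sigma>'. \<bar>real (state_count N \<sigma>' s') - ?M \<sigma>\<bar> / N + ?D \<sigma>)"
        by (intro expectation_mono_finite_pmf step) simp
      also have "\<dots> = measure_pmf.expectation (next_states B \<pi> N (Suc n) \<sigma>)
          (\<lambda>\<sigma>'. \<bar>real (state_count N \<sigma>' s') - ?M \<sigma>\<bar>) / N + ?D \<sigma>"
        by simp
      also have "\<dots> \<le> sqrt N / N + ?D \<sigma>"
        by (intro add_right_mono divide_right_mono next_states_concentrate[OF policy adm n']) simp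
      also have "sqrt N / N = 1 / sqrt N" using N by (simp add: field_simps)
      finally show ?thesis .
    qed
    then have "state_error (Suc n) s' N \<le>
        measure_pmf.expectation (arms_law B \<pi> N n) (\<lambda>\<sigma>. 1 / sqrt N + ?D \<sigma>)"
      unfolding state_error_def arms_law.simps
      by (subst expectation_bind_finite_pmf[OF finite_arms_law finite_next_states])
         (rule expectation_mono_finite_pmf[OF finite_arms_law])
    also have "\<dots> = ?bound N"
      by (simp add: action_error_def Bochner_Integration.integral_sum)
    finally show ?thesis .
  qed
  then have upper: "\<forall>\<^sub>F N in large_N B. state_error (Suc n) s' N \<le> ?bound N"
    by (intro eventually_mono[OF eventually_admissible])
  have "(?bound \<longlongrightarrow> 0 + (\<Sum>s\<in>UNIV. \<Sum>a\<in>UNIV. ?P s a * 0)) (large_N B)"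
    by (intro tendsto_intros tendsto_inverse_sqrt_large_N action)
  then have bound_lim: "(?bound \<longlongrightarrow> 0) (large_N B)" by simp
  show ?thesis
    by (rule tendsto_sandwich[OF _ upper tendsto_const bound_lim])
       (auto simp: state_error_def intro!: always_eventually Bochner_Integration.integral_nonneg)
qed

lemma action_error_lim:
  "Suc n \<in> {1..horizon B} \<Longrightarrow> (action_error n s a \<longlongrightarrow> 0) (large_N B)"
proof (induction n arbitrary: s a)
  case 0
  then show ?case by (intro action_error_tendsto_0 state_error_0)
next
  case (Suc n)
  then have "(action_error n s a \<longlongrightarrow> 0) (large_N B)" for s a by simp
  then show ?case
    using Suc.prems by (intro action_error_tendsto_0[OF Suc.prems] state_error_Suc[OF Suc.prems])
qed

lemma mean_actions_tendsto:
  assumes t: "t \<in> {1..horizon B}"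
  shows "((\<lambda>N. mean_actions B \<pi> N t s a) \<longlongrightarrow> x t s a) (large_N B)"
proof -
  obtain n where n: "t = Suc n" using t by (cases t) auto
  have le: "norm (mean_actions B \<pi> N t s a - x t s a) \<le> action_error n s a N" for N
  proof -
    have "mean_actions B \<pi> N t s a - x t s a = measure_pmf.expectation (arms_law B \<pi> N n)
        (\<lambda>\<sigma>. \<pi> N t (state_count N \<sigma>) s a / real N - x t s a)"
      unfolding mean_actions_def n by simp
    then show ?thesis
      using abs_expectation_le unfolding action_error_def n by (simp only: real_norm_def)
  qed
  have "(action_error n s a \<longlongrightarrow> 0) (large_N B)" using t n by (simp add: action_error_lim)
  then have "((\<lambda>N. mean_actions B \<pi> N t s a - x t s a) \<longlongrightarrow> 0) (large_N B)"
    by (rule Lim_null_comparison[OF always_eventually[OF allI[OF le]]])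
  then show ?thesis by (rule LIM_zero_cancel)
qed

end

theorem theorem1:
  fixes B :: "'s::finite bandit" and x :: "nat \<Rightarrow> 's \<Rightarrow> bool \<Rightarrow> real" and \<pi> :: "'s policy"
  assumes "valid_bandit B"
    and "optimal_occupation_measure B x"
    and "is_policy B \<pi>"
    and "fluid_consistent B x \<pi>"
  shows "(\<lambda>N. optimal_value B N - policy_value B \<pi> N) \<in> o[large_N B](\<lambda>N. real N)"
proof (rule smalloI_tendsto)
  have occ: "occupation_measure B x" using assms(2) by (simp add: optimal_occupation_measure_def)
  have gap: "0 \<le> (optimal_value B N - policy_value B \<pi> N) / N \<and>
      (optimal_value B N - policy_value B \<pi> N) / N
        \<le> lp_objective B x - lp_objective B (mean_actions B \<pi> N)"
    if adm: "admissible B N" for N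
  proof -
    have N: "0 < real N" using adm by (simp add: admissible_def)
    have le: "policy_value B \<rho> N \<le> real N * lp_objective B x" if "is_policy B \<rho>" for \<rho>
      using policy_value_le_lp_optimum[OF assms(1,2) that adm] .
    \<comment> \<open>The uniform bound also makes the supremum over all policies meaningful: it bounds the set of
      their values from above, and \<open>\<pi>\<close> shows that this set is nonempty.\<close>
    have "optimal_value B N \<le> real N * lp_objective B x"
      unfolding optimal_value_def using assms(3) le by (intro cSUP_least) auto
    moreover have "policy_value B \<pi> N \<le> optimal_value B N"
      unfolding optimal_value_def using assms(3) le
      by (intro cSUP_upper bdd_aboveI2[of _ _ "real N * lp_objective B x"]) auto
    ultimately show ?thesis
      using N by (simp add: policy_value_eq_lp_objective[OF assms(3) adm] field_simps)
  qed
  have "((\<lambda>N. lp_objective B x - lp_objective B (mean_actions B \<pi> N)) \<longlongrightarrow>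
      lp_objective B x - lp_objective B x) (large_N B)"
    unfolding lp_objective_def
    by (intro tendsto_intros mean_actions_tendsto[OF assms(1) occ assms(3,4)])
  then have lim: "((\<lambda>N. lp_objective B x - lp_objective B (mean_actions B \<pi> N)) \<longlongrightarrow> 0) (large_N B)"
    by simp
  show "((\<lambda>N. (optimal_value B N - policy_value B \<pi> N) / real N) \<longlongrightarrow> 0) (large_N B)"
    by (rule tendsto_sandwich[OF _ _ tendsto_const lim]; rule eventually_mono[OF eventually_admissible])
       (use gap in blast)+
  show "\<forall>\<^sub>F N in large_N B. real N \<noteq> 0"
    by (rule eventually_mono[OF eventually_admissible]) (simp add: admissible_def)
qed

end
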